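(* Let $(M,\mathrm{acc},\mathrm{rej})$ be a monitoring system that is maximal for the collection $2^{\mathrm{Act}^\infty}$ of all properties, and let the classes $\mathcal{S},\mathcal{U},\mathcal{PU},\mathcal{P},\mathcal{SC},\mathcal{VC},\mathcal{C}$ be defined with respect to this system as in the context. Then $$\mathcal{C}\subseteq \mathcal{SC}\subseteq \mathcal{P},\qquad \mathcal{C}\subseteq \mathcal{VC}\subseteq \mathcal{P},\qquad \mathcal{P}=\mathcal{SC}\cup\mathcal{VC}\subseteq \mathcal{PU}\subseteq \mathcal{U}\subseteq \mathcal{S}.$$
   Context: Fix a finite set $\mathrm{Act}$ of actions. Finite traces are elements of $\mathrm{Act}^*$, infinite traces elements of $\mathrm{Act}^\omega$, and finfinite traces elements of $\mathrm{Act}^\infty=\mathrm{Act}^*\cup\mathrm{Act}^\omega$. Write $s\preceq f$ when the finite trace $s$ is a prefix of $f$. A property is a subset $P\subseteq\mathrm{Act}^\infty$. A finite trace $s$ positively (resp. negatively) determines $P$ if $sf\in P$ (resp. $sf\notin P$) for every $f\in\mathrm{Act}^\infty$. A monitoring system is a triple $(M,\mathrm{acc},\mathrm{rej})$ where $M$ is a nonempty set of monitors and $\mathrm{acc},\mathrm{rej}\subseteq M\times\mathrm{Act}^\infty$, such that for every $m\in M$: (1) if $\mathrm{acc}(m,f)$ then $\mathrm{acc}(m,s)$ for some finite $s\preceq f$, and likewise for $\mathrm{rej}$; (2) if $\mathrm{acc}(m,s)$ for finite $s$ then $\mathrm{acc}(m,sf)$ for all $f\in\mathrm{Act}^\infty$,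 and likewise for $\mathrm{rej}$. It is maximal for a collection $C$ of properties if for every $P\in C$ there is $m_P\in M$ such that $\mathrm{acc}(m_P,f)$ iff $f$ has a finite prefix that positively determines $P$, and $\mathrm{rej}(m_P,f)$ iff $f$ has a finite prefix that negatively determines $P$. A monitor $m$ is sound for $P$ if $\mathrm{acc}(m,f)$ implies $f\in P$ and $\mathrm{rej}(m,f)$ implies $f\notin P$; satisfaction-complete for $P$ if $f\in P$ implies $\mathrm{acc}(m,f)$; violation-complete for $P$ if $f\notin P$ implies $\mathrm{rej}(m,f)$; complete if both. $m$ is informative if $\exists f.\,(\mathrm{acc}(m,f)$ or $\mathrm{rej}(m,f))$, and persistently informative if for every $s\in\mathrm{Act}^*$ there is $f\in\mathrm{Act}^\infty$ with $\mathrm{acc}(m,sf)$ or $\mathrm{rej}(m,sf)$. Classes (all with monitors from $M$): $\mathcal{S}$ = properties having a sound monitor; $\mathcal{U}$ = properties having a sound informative monitor; $\mathcal{PU}$ = properties having a sound persistently informative monitor; $\mathcal{SC}$ (resp. $\mathcal{VC}$) = properties having a monitor that is sound and satisfaction-complete (resp. violation-complete); $\mathcal{P}$ = properties in $\mathcal{SC}$ or in $\mathcal{VC}$; $\mathcal{C}$ = properties having a sound and complete monitor. *)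

theory Defs
  imports Main "HOL-Library.Stream"
begin

datatype 'a trace = Fin "'a list" | Inf "'a stream"

text \<open>\<open>finf_traces Act\<close> is \<open>Act\<^sup>\<infinity>\<close>, the finite and infinite traces over the actions \<open>Act\<close>.\<close>

definition finf_traces :: "'a set \<Rightarrow> 'a trace set" where
  "finf_traces Act = Fin ` lists Act \<union> Inf ` streams Act"

fun tconc :: "'a list \<Rightarrow> 'a trace \<Rightarrow> 'a trace"  (infixr \<open>\<cdot>\<close> 65) where
  "s \<cdot> Fin t = Fin (s @ t)"
| "s \<cdot> Inf w = Inf (s @- w)"

text \<open>If \<open>s \<preceq> f\<close> and \<open>f \<in> finf_traces Act\<close>, then \<open>s \<in> lists Act\<close>; so prefixes of traces over \<open>Act\<close>
  need no separate restriction below.\<close>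

definition tprefix :: "'a list \<Rightarrow> 'a trace \<Rightarrow> bool"  (infix \<open>\<preceq>\<close> 50) where
  "s \<preceq> f \<longleftrightarrow> (\<exists>g. f = s \<cdot> g)"

definition pos_determines :: "'a set \<Rightarrow> 'a list \<Rightarrow> 'a trace set \<Rightarrow> bool" where
  "pos_determines Act s P \<longleftrightarrow> (\<forall>f \<in> finf_traces Act. s \<cdot> f \<in> P)"

definition neg_determines :: "'a set \<Rightarrow> 'a list \<Rightarrow> 'a trace set \<Rightarrow> bool" where
  "neg_determines Act s P \<longleftrightarrow> (\<forall>f \<in> finf_traces Act. s \<cdot> f \<notin> P)"

record ('m, 'a) monitors =
  mons :: "'m set"
  acc :: "('m \<times> 'a trace) set"
  rej :: "('m \<times> 'a trace) set"

definition monitoring_system :: "'a set \<Rightarrow> ('m, 'a) monitors \<Rightarrow> bool" where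
  "monitoring_system Act MS \<longleftrightarrow>
     mons MS \<noteq> {} \<and>
     acc MS \<subseteq> mons MS \<times> finf_traces Act \<and>
     rej MS \<subseteq> mons MS \<times> finf_traces Act \<and>
     (\<forall>m \<in> mons MS.
        (\<forall>f \<in> finf_traces Act. (m, f) \<in> acc MS \<longrightarrow> (\<exists>s. s \<preceq> f \<and> (m, Fin s) \<in> acc MS)) \<and>
        (\<forall>f \<in> finf_traces Act. (m, f) \<in> rej MS \<longrightarrow> (\<exists>s. s \<preceq> f \<and> (m, Fin s) \<in> rej MS)) \<and>
        (\<forall>s \<in> lists Act. (m, Fin s) \<in> acc MS \<longrightarrow>
           (\<forall>f \<in> finf_traces Act. (m, s \<cdot> f) \<in> acc MS)) \<and>
        (\<forall>s \<in> lists Act. (m, Fin s) \<in> rej MS \<longrightarrow>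
           (\<forall>f \<in> finf_traces Act. (m, s \<cdot> f) \<in> rej MS)))"

definition maximal_for :: "'a set \<Rightarrow> ('m, 'a) monitors \<Rightarrow> 'a trace set set \<Rightarrow> bool" where
  "maximal_for Act MS C \<longleftrightarrow>
     (\<forall>P \<in> C. \<exists>m \<in> mons MS. \<forall>f \<in> finf_traces Act.
        ((m, f) \<in> acc MS \<longleftrightarrow> (\<exists>s. s \<preceq> f \<and> pos_determines Act s P)) \<and>
        ((m, f) \<in> rej MS \<longleftrightarrow> (\<exists>s. s \<preceq> f \<and> neg_determines Act s P)))"

definition sound :: "'a set \<Rightarrow> ('m, 'a) monitors \<Rightarrow> 'm \<Rightarrow> 'a trace set \<Rightarrow> bool" where
  "sound Act MS m P \<longleftrightarrow>
     (\<forall>f \<in> finf_traces Act. ((m, f) \<in> acc MS \<longrightarrow> f \<in> P) \<and> ((m, f) \<in> rej MS \<longrightarrow> f \<notin> P))"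

definition sat_complete :: "'a set \<Rightarrow> ('m, 'a) monitors \<Rightarrow> 'm \<Rightarrow> 'a trace set \<Rightarrow> bool" where
  "sat_complete Act MS m P \<longleftrightarrow> (\<forall>f \<in> finf_traces Act. f \<in> P \<longrightarrow> (m, f) \<in> acc MS)"

definition viol_complete :: "'a set \<Rightarrow> ('m, 'a) monitors \<Rightarrow> 'm \<Rightarrow> 'a trace set \<Rightarrow> bool" where
  "viol_complete Act MS m P \<longleftrightarrow> (\<forall>f \<in> finf_traces Act. f \<notin> P \<longrightarrow> (m, f) \<in> rej MS)"

definition mon_complete :: "'a set \<Rightarrow> ('m, 'a) monitors \<Rightarrow> 'm \<Rightarrow> 'a trace set \<Rightarrow> bool" where
  "mon_complete Act MS m P \<longleftrightarrow> sat_complete Act MS m P \<and> viol_complete Act MS m P"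

definition informative :: "'a set \<Rightarrow> ('m, 'a) monitors \<Rightarrow> 'm \<Rightarrow> bool" where
  "informative Act MS m \<longleftrightarrow> (\<exists>f \<in> finf_traces Act. (m, f) \<in> acc MS \<or> (m, f) \<in> rej MS)"

definition pers_informative :: "'a set \<Rightarrow> ('m, 'a) monitors \<Rightarrow> 'm \<Rightarrow> bool" where
  "pers_informative Act MS m \<longleftrightarrow>
     (\<forall>s \<in> lists Act. \<exists>f \<in> finf_traces Act. (m, s \<cdot> f) \<in> acc MS \<or> (m, s \<cdot> f) \<in> rej MS)"

definition class_S :: "'a set \<Rightarrow> ('m, 'a) monitors \<Rightarrow> 'a trace set set" where
  "class_S Act MS = {P \<in> Pow (finf_traces Act). \<exists>m \<in> mons MS. sound Act MS m P}"

definition class_U :: "'a set \<Rightarrow> ('m, 'a) monitors \<Rightarrow> 'a trace set set" where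
  "class_U Act MS = {P \<in> Pow (finf_traces Act).
     \<exists>m \<in> mons MS. sound Act MS m P \<and> informative Act MS m}"

definition class_PU :: "'a set \<Rightarrow> ('m, 'a) monitors \<Rightarrow> 'a trace set set" where
  "class_PU Act MS = {P \<in> Pow (finf_traces Act).
     \<exists>m \<in> mons MS. sound Act MS m P \<and> pers_informative Act MS m}"

definition class_SC :: "'a set \<Rightarrow> ('m, 'a) monitors \<Rightarrow> 'a trace set set" where
  "class_SC Act MS = {P \<in> Pow (finf_traces Act).
     \<exists>m \<in> mons MS. sound Act MS m P \<and> sat_complete Act MS m P}"

definition class_VC :: "'a set \<Rightarrow> ('m, 'a) monitors \<Rightarrow> 'a trace set set" where
  "class_VC Act MS = {P \<in> Pow (finf_traces Act).
     \<exists>m \<in> mons MS. sound Act MS m P \<and> viol_complete Act MS m P}"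

definition class_P :: "'a set \<Rightarrow> ('m, 'a) monitors \<Rightarrow> 'a trace set set" where
  "class_P Act MS = {P \<in> Pow (finf_traces Act). P \<in> class_SC Act MS \<or> P \<in> class_VC Act MS}"

definition class_C :: "'a set \<Rightarrow> ('m, 'a) monitors \<Rightarrow> 'a trace set set" where
  "class_C Act MS = {P \<in> Pow (finf_traces Act).
     \<exists>m \<in> mons MS. sound Act MS m P \<and> mon_complete Act MS m P}"

end

theory Submission
  imports Defs
begin

text \<open>The interesting inclusion is \<open>\<P> \<subseteq> \<P>\<U>\<close>. Let \<open>m\<close> be sound and satisfaction-complete for \<open>P\<close>, and take
  the monitor \<open>m\<^sub>P\<close> given by maximality. If some extension \<open>sf\<close> of \<open>s\<close> lies in \<open>P\<close>, then \<open>m\<close> accepts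
  a finite prefix of \<open>sf\<close>, which by soundness of \<open>m\<close> positively determines \<open>P\<close>, so \<open>m\<^sub>P\<close> accepts \<open>sf\<close>.
  If there is no such extension, then \<open>s\<close> negatively determines \<open>P\<close> and \<open>m\<^sub>P\<close> rejects \<open>s\<close>.
  Violation-completeness is dual.\<close>

lemma tconc_in_finf_traces_iff [simp]:
  "s \<cdot> f \<in> finf_traces Act \<longleftrightarrow> s \<in> lists Act \<and> f \<in> finf_traces Act"
  by (cases f) (auto simp: finf_traces_def streams_iff_sset image_iff)

lemma tconc_Nil [simp]: "[] \<cdot> f = f"
  by (cases f) auto

lemma Fin_in_finf_traces_iff [simp]: "Fin s \<in> finf_traces Act \<longleftrightarrow> s \<in> lists Act"
  by (auto simp: finf_traces_def)

lemma tprefix_tconc [simp]: "s \<preceq> s \<cdot> f"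
  by (auto simp: tprefix_def)

text \<open>The finite prefix behind a verdict comes with no constraint on its letters, while
  closure of verdicts under extension asks for \<open>s \<in> lists Act\<close>; this bridges the
  two.\<close>

lemma tprefix_in_lists:
  assumes "s \<preceq> f" and "f \<in> finf_traces Act"
  shows "s \<in> lists Act"
  using assms by (auto simp: tprefix_def)

lemma pos_determines_tprefix:
  assumes "s \<preceq> f" and "f \<in> finf_traces Act" and "pos_determines Act s P"
  shows "f \<in> P"
  using assms by (auto simp: tprefix_def pos_determines_def)

lemma neg_determines_tprefix:
  assumes "s \<preceq> f" and "f \<in> finf_traces Act" and "neg_determines Act s P"
  shows "f \<notin> P"
  using assms by (auto simp: tprefix_def neg_determines_def)

lemma accepted_finite_prefix:
  assumes "monitoring_system Act MS" and "m \<in> mons MS"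
    and "f \<in> finf_traces Act" and "(m, f) \<in> acc MS"
  shows "\<exists>s. s \<preceq> f \<and> (m, Fin s) \<in> acc MS"
  using assms by (simp add: monitoring_system_def)

lemma accepted_extension:
  assumes "monitoring_system Act MS" and "m \<in> mons MS"
    and "s \<in> lists Act" and "(m, Fin s) \<in> acc MS" and "f \<in> finf_traces Act"
  shows "(m, s \<cdot> f) \<in> acc MS"
  using assms by (simp add: monitoring_system_def)

lemma rejected_finite_prefix:
  assumes "monitoring_system Act MS" and "m \<in> mons MS"
    and "f \<in> finf_traces Act" and "(m, f) \<in> rej MS"
  shows "\<exists>s. s \<preceq> f \<and> (m, Fin s) \<in> rej MS"
  using assms by (simp add: monitoring_system_def)

lemma rejected_extension:
  assumes "monitoring_system Act MS" and "m \<in> mons MS"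
    and "s \<in> lists Act" and "(m, Fin s) \<in> rej MS" and "f \<in> finf_traces Act"
  shows "(m, s \<cdot> f) \<in> rej MS"
  using assms by (simp add: monitoring_system_def)

text \<open>Acceptance is already reached on a finite prefix and then persists on all its
  extensions; soundness puts each of these extensions in \<open>P\<close>. So a sound monitor
  accepts only where \<open>m\<^sub>P\<close> does.\<close>

lemma accepted_imp_pos_determined_prefix:
  assumes "monitoring_system Act MS" and m: "m \<in> mons MS" "sound Act MS m P"
    and f: "f \<in> finf_traces Act" "(m, f) \<in> acc MS"
  shows "\<exists>s. s \<preceq> f \<and> pos_determines Act s P"
proof -
  obtain s where s: "s \<preceq> f" "(m, Fin s) \<in> acc MS"
    using accepted_finite_prefix[OF assms(1) m(1) f] by blast
  have sA: "s \<in> lists Act"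
    using s(1) f(1) by (rule tprefix_in_lists)
  have "(m, s \<cdot> g) \<in> acc MS" if "g \<in> finf_traces Act" for g
    using accepted_extension[OF assms(1) m(1) sA s(2) that] .
  then have "pos_determines Act s P"
    using m(2) sA unfolding pos_determines_def sound_def
    by simp
  with s(1) show ?thesis by blast
qed

lemma rejected_imp_neg_determined_prefix:
  assumes "monitoring_system Act MS" and m: "m \<in> mons MS" "sound Act MS m P"
    and f: "f \<in> finf_traces Act" "(m, f) \<in> rej MS"
  shows "\<exists>s. s \<preceq> f \<and> neg_determines Act s P"
proof -
  obtain s where s: "s \<preceq> f" "(m, Fin s) \<in> rej MS"
    using rejected_finite_prefix[OF assms(1) m(1) f] by blast
  have sA: "s \<in> lists Act"
    using s(1) f(1) by (rule tprefix_in_lists)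
  have "(m, s \<cdot> g) \<in> rej MS" if "g \<in> finf_traces Act" for g
    using rejected_extension[OF assms(1) m(1) sA s(2) that] .
  then have "neg_determines Act s P"
    using m(2) sA unfolding neg_determines_def sound_def
    by simp
  with s(1) show ?thesis by blast
qed

text \<open>This is where maximality enters: it reduces persistent informativeness to a condition on
  \<open>P\<close> alone. The determining prefix \<open>t\<close> may be shorter or longer than
  \<open>s\<close>, since a verdict on \<open>s \<cdot> f\<close> may be reached before or after
  \<open>s\<close> ends.\<close>

lemma class_PU_if_determined_extensions:
  assumes "maximal_for Act MS (Pow (finf_traces Act))" and P: "P \<subseteq> finf_traces Act"
    and det: "\<And>s. s \<in> lists Act \<Longrightarrow> \<exists>f \<in> finf_traces Act. \<exists>t. t \<preceq> s \<cdot> f \<and>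
      (pos_determines Act t P \<or> neg_determines Act t P)"
  shows "P \<in> class_PU Act MS"
proof -
  \<comment> \<open>The monitor \<open>m\<^sub>P\<close>; its verdicts are exactly those forced by
    determining prefixes.\<close>
  obtain m where m: "m \<in> mons MS"
    and acc: "\<And>f. f \<in> finf_traces Act \<Longrightarrow>
      (m, f) \<in> acc MS \<longleftrightarrow> (\<exists>s. s \<preceq> f \<and> pos_determines Act s P)"
    and rej: "\<And>f. f \<in> finf_traces Act \<Longrightarrow>
      (m, f) \<in> rej MS \<longleftrightarrow> (\<exists>s. s \<preceq> f \<and> neg_determines Act s P)"
    using bspec[OF assms(1)[unfolded maximal_for_def] PowI[OF P]] by metis
  \<comment> \<open>Every verdict has a determining prefix as witness, so it is correct for any
    \<open>P\<close>.\<close>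
  have "sound Act MS m P"
    unfolding sound_def
  proof (intro ballI conjI impI)
    fix f assume f: "f \<in> finf_traces Act"
    show "f \<in> P" if "(m, f) \<in> acc MS"
      using acc[OF f] that pos_determines_tprefix[OF _ f] by blast
    show "f \<notin> P" if "(m, f) \<in> rej MS"
      using rej[OF f] that neg_determines_tprefix[OF _ f] by blast
  qed
  moreover have "pers_informative Act MS m"
    unfolding pers_informative_def
  proof
    fix s assume s: "s \<in> lists Act"
    then obtain f t where f: "f \<in> finf_traces Act" and t: "t \<preceq> s \<cdot> f"
      "pos_determines Act t P \<or> neg_determines Act t P"
      using det by blast
    have "s \<cdot> f \<in> finf_traces Act"
      unfolding tconc_in_finf_traces_iff using s f by blast
    then have "(m, s \<cdot> f) \<in> acc MS \<or> (m, s \<cdot> f) \<in> rej MS"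
      using acc[of "s \<cdot> f"] rej[of "s \<cdot> f"] t by blast
    with f show "\<exists>f \<in> finf_traces Act. (m, s \<cdot> f) \<in> acc MS \<or> (m, s \<cdot> f) \<in> rej MS"
      by blast
  qed
  ultimately show ?thesis
    using m P unfolding class_PU_def by blast
qed

lemma class_SC_subset_class_PU:
  assumes "monitoring_system Act MS" and "maximal_for Act MS (Pow (finf_traces Act))"
  shows "class_SC Act MS \<subseteq> class_PU Act MS"
proof
  fix P assume "P \<in> class_SC Act MS"
  then obtain m where P: "P \<subseteq> finf_traces Act"
    and m: "m \<in> mons MS" "sound Act MS m P" "sat_complete Act MS m P"
    unfolding class_SC_def by blast
  show "P \<in> class_PU Act MS"
  proof (rule class_PU_if_determined_extensions[OF assms(2) P])
    fix s assume s: "s \<in> lists Act"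
    show "\<exists>f \<in> finf_traces Act. \<exists>t. t \<preceq> s \<cdot> f \<and>
      (pos_determines Act t P \<or> neg_determines Act t P)"
    proof (cases "neg_determines Act s P")
      case True
      \<comment> \<open>The witnesses are the empty continuation and \<open>t = s\<close>.\<close>
      moreover have "Fin [] \<in> finf_traces Act" by simp
      ultimately show ?thesis using tprefix_tconc by blast
    next
      case False
      then obtain f where f: "f \<in> finf_traces Act" "s \<cdot> f \<in> P"
        unfolding neg_determines_def by blast
      have sf: "s \<cdot> f \<in> finf_traces Act"
        using P f(2) by blast
      then have "(m, s \<cdot> f) \<in> acc MS"
        using m(3) f(2) unfolding sat_complete_def by blast
      then show ?thesis
        using accepted_imp_pos_determined_prefix[OF assms(1) m(1,2) sf] f(1) by blast
    qed
  qed
qed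

lemma class_VC_subset_class_PU:
  assumes "monitoring_system Act MS" and "maximal_for Act MS (Pow (finf_traces Act))"
  shows "class_VC Act MS \<subseteq> class_PU Act MS"
proof
  fix P assume "P \<in> class_VC Act MS"
  then obtain m where P: "P \<subseteq> finf_traces Act"
    and m: "m \<in> mons MS" "sound Act MS m P" "viol_complete Act MS m P"
    unfolding class_VC_def by blast
  show "P \<in> class_PU Act MS"
  proof (rule class_PU_if_determined_extensions[OF assms(2) P])
    fix s assume s: "s \<in> lists Act"
    show "\<exists>f \<in> finf_traces Act. \<exists>t. t \<preceq> s \<cdot> f \<and>
      (pos_determines Act t P \<or> neg_determines Act t P)"
    proof (cases "pos_determines Act s P")
      case True
      moreover have "Fin [] \<in> finf_traces Act" by simp
      ultimately show ?thesis using tprefix_tconc by blast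
    next
      case False
      then obtain f where f: "f \<in> finf_traces Act" "s \<cdot> f \<notin> P"
        unfolding pos_determines_def by blast
      \<comment> \<open>Here \<open>s \<cdot> f\<close> lies outside \<open>P\<close>, so, unlike in
        the satisfaction-complete case, its being a trace over \<open>Act\<close> must come from
        \<open>s\<close> and \<open>f\<close> themselves.\<close>
      have sf: "s \<cdot> f \<in> finf_traces Act"
        using s f(1) by simp
      then have "(m, s \<cdot> f) \<in> rej MS"
        using m(3) f(2) unfolding viol_complete_def by blast
      then show ?thesis
        using rejected_imp_neg_determined_prefix[OF assms(1) m(1,2) sf] f(1) by blast
    qed
  qed
qed

lemma pers_informative_imp_informative:
  assumes "pers_informative Act MS m"
  shows "informative Act MS m"
proof -
  \<comment> \<open>Persistent informativeness is instantiated at the empty trace.\<close>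
  obtain f where "f \<in> finf_traces Act" "(m, [] \<cdot> f) \<in> acc MS \<or> (m, [] \<cdot> f) \<in> rej MS"
    using assms unfolding pers_informative_def by (meson lists.Nil)
  then show ?thesis
    unfolding informative_def by auto
qed

theorem theorem1:
  fixes Act :: "'a set" and MS :: "('m, 'a) monitors"
  assumes "finite Act"
    and "monitoring_system Act MS"
    and "maximal_for Act MS (Pow (finf_traces Act))"
  shows "class_C Act MS \<subseteq> class_SC Act MS \<and> class_SC Act MS \<subseteq> class_P Act MS \<and>
    class_C Act MS \<subseteq> class_VC Act MS \<and> class_VC Act MS \<subseteq> class_P Act MS \<and>
    class_P Act MS = class_SC Act MS \<union> class_VC Act MS \<and>
    class_P Act MS \<subseteq> class_PU Act MS \<and>
    class_PU Act MS \<subseteq> class_U Act MS \<and> class_U Act MS \<subseteq> class_S Act MS"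
proof (intro conjI)
  \<comment> \<open>One sound and complete monitor witnesses membership in both one-sided
    classes.\<close>
  show "class_C Act MS \<subseteq> class_SC Act MS" "class_C Act MS \<subseteq> class_VC Act MS"
    unfolding class_C_def class_SC_def class_VC_def mon_complete_def by blast+
  show P: "class_P Act MS = class_SC Act MS \<union> class_VC Act MS"
    unfolding class_P_def class_SC_def class_VC_def by blast
  then show "class_SC Act MS \<subseteq> class_P Act MS" "class_VC Act MS \<subseteq> class_P Act MS"
    by simp_all
  show "class_P Act MS \<subseteq> class_PU Act MS"
    unfolding P
    using class_SC_subset_class_PU[OF assms(2,3)] class_VC_subset_class_PU[OF assms(2,3)]
    by (rule Un_least)
  \<comment> \<open>In this inclusion and the next the monitor stays the same; only the demand on it
    weakens.\<close>
  show "class_PU Act MS \<subseteq> class_U Act MS"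
    by (auto simp: class_PU_def class_U_def intro: pers_informative_imp_informative)
  show "class_U Act MS \<subseteq> class_S Act MS"
    by (auto simp: class_U_def class_S_def)
qed

end
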